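(* The generating functions of $x\delta_k(x)$ and $x\delta_k(k+x)$ are, as formal power series in $u$ with coefficients polynomial in $x$, $$\sum_{k\ge0}x\,\delta_k(x)\,u^k=(u\coth u)^x=\left(\sum_{j\ge0}2^{2j}\frac{B_{2j}}{(2j)!}u^{2j}\right)^x,$$ $$\sum_{k\ge0}x\,\delta_k(k+x)\,u^k=\left(\frac1u\operatorname{artanh}u\right)^x=\left(\frac1{2u}\ln\frac{1+u}{1-u}\right)^x=\left(\sum_{j\ge0}\frac1{2j+1}u^{2j}\right)^x,$$ where $B_{2j}$ are the Bernoulli numbers.
   Context: Let $\theta(n,m)$ be defined for integers $n,m\ge0$ by $\sum_n\theta(n,m)\frac{u^n}{n!}=\frac1{m!}(\operatorname{artanh}u)^m$. For each fixed integer $k\ge0$, $\theta(n,n-k)$, for integers $n\ge k$, is the value at $x=n$ of a unique polynomial in $x$, denoted $\theta(x,x-k)$. The tanh polynomials are $\delta_k(x)=\theta(x,x-k)/x^{\underline{k+1}}$, where $x^{\underline{k+1}}=x(x-1)\cdots(x-k)$; $\delta_k$ is a polynomial for $k\ge1$, and $\delta_0(x)=1/x$, so $x\delta_0(x)\equiv1$. For a formal power series $F(u)$ with constant term $1$, $F(u)^x=\exp(x\ln F(u))$. *)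

theory Defs
  imports "HOL-Computational_Algebra.Computational_Algebra"
begin

definition fps_sinh :: "'a::field_char_0 fps" where
  "fps_sinh = fps_const (1 / 2) * (fps_exp 1 - fps_exp (- 1))"

definition fps_cosh :: "'a::field_char_0 fps" where
  "fps_cosh = fps_const (1 / 2) * (fps_exp 1 + fps_exp (- 1))"

definition fps_artanh :: "'a::field_char_0 fps" where
  "fps_artanh = fps_inv (fps_sinh / fps_cosh)"
  \<comment> \<open>compositional inverse of the tanh series\<close>

text \<open>The series coth u has a pole at 0, but u coth u = (u cosh u) / sinh u is a power series:
  the division of power series below is exact and cancels the common factor u.\<close>

definition fps_X_coth :: "'a::field_char_0 fps" where
  "fps_X_coth = (fps_X * fps_cosh) / fps_sinh"

text \<open>Logarithm and general power of a series with constant term 1. Note that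
  \<^term>\<open>fps_ln 1\<close> is the series ln (1 + u).\<close>

definition fps_log :: "'a::field_char_0 fps \<Rightarrow> 'a fps" where
  "fps_log F = fps_ln 1 oo (F - 1)"

definition fps_pow :: "'a::field_char_0 fps \<Rightarrow> 'a \<Rightarrow> 'a fps" where
  "fps_pow F x = fps_exp 1 oo (fps_const x * fps_log F)"

definition even_series :: "(nat \<Rightarrow> 'a::comm_ring_1) \<Rightarrow> 'a fps" where
  "even_series a = Abs_fps a oo fps_X\<^sup>2"
  \<comment> \<open>the sum over j of a j * u ^ (2 * j)\<close>

definition bernoulli :: "nat \<Rightarrow> rat" where
  "bernoulli n = fact n * fps_nth (fps_X / (fps_exp 1 - 1)) n"

definition theta :: "nat \<Rightarrow> nat \<Rightarrow> rat" where
  "theta n m = fact n * fps_nth (fps_const (1 / fact m) * fps_artanh ^ m) n"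

definition theta_poly :: "nat \<Rightarrow> rat poly" where
  "theta_poly k = (THE p. \<forall>n\<ge>k. poly p (of_nat n) = theta n (n - k))"

text \<open>The value at y of the rational function \<open>\<delta>\<^sub>k(x) = \<theta>(x, x - k) / (x (x - 1) \<dots> (x - k))\<close>, where
  y may lie in any field of characteristic 0. Taking y in the field of rational functions gives
  \<open>\<delta>\<^sub>k\<close> itself, and also its substitution instances such as \<open>\<delta>\<^sub>k(k + x)\<close>, with no vanishing
  denominators. Only at the points y = 0, ..., k is the value 0 by the convention on division.\<close>

definition tanh_delta :: "nat \<Rightarrow> 'a::field_char_0 \<Rightarrow> 'a" where
  "tanh_delta k y = poly (map_poly of_rat (theta_poly k)) y / (\<Prod>i\<le>k. y - of_nat i)"

text \<open>The indeterminate x in the field of rational functions over the rationals;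
  \<^term>\<open>range to_fract\<close> consists of the polynomials inside that field.\<close>

definition indet :: "rat poly fract" where
  "indet = to_fract [:0, 1:]"

end

theory Submission
  imports Defs
begin

text \<open>
  Let \<open>B = artanh u / u\<close> and \<open>C = u coth u\<close>, two series with constant term 1. The coefficient of
  \<open>u ^ k\<close> in a power \<open>F\<^sup>y\<close> of such a series is a polynomial in y (\<open>pow_poly\<close>); let \<open>P\<^sub>k\<close> and
  \<open>Q\<^sub>k\<close> be these polynomials for B and C.

  By definition \<open>\<theta>(n, n - k)\<close> is \<open>n! / (n - k)!\<close> times the coefficient of \<open>u ^ n\<close> in
  \<open>artanh\<^bsup>n - k\<^esup> u\<close>, that is, \<open>n (n - 1) \<dots> (n - k + 1) P\<^sub>k(n - k)\<close>. A polynomial is determined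
  by its values at infinitely many natural numbers, so \<open>\<theta>(x, x - k)\<close> is the polynomial
  \<open>x (x - 1) \<dots> (x - k + 1) P\<^sub>k(x - k)\<close>, and dividing by \<open>x (x - 1) \<dots> (x - k)\<close> gives
  \<open>\<delta>\<^sub>k(x) = P\<^sub>k(x - k) / (x - k)\<close> (\<open>tanh_delta_conv_pow_poly\<close>). Replacing x by \<open>k + x\<close> yields
  \<open>x \<delta>\<^sub>k(k + x) = P\<^sub>k(x)\<close>, which is the second generating function.

  For the first one, \<open>x P\<^sub>k(x - k) = (x - k) Q\<^sub>k(x)\<close> is needed (\<open>pow_poly_artanh_X_coth\<close>). At a
  natural number \<open>x = n \<ge> k\<close> this is Lagrange's inversion formula
  \<open>n [u\<^sup>n] g\<^sup>m = m [u\<^bsup>n - m\<^esup>] \<phi>\<^sup>n\<close> with \<open>m = n - k\<close>, for \<open>g = artanh\<close>, the inverse of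
  \<open>tanh u = u / \<phi>(u)\<close>, where \<open>\<phi> = C\<close>.

  The remaining equalities hold already between the bases of the powers. Those for artanh follow
  from the differential equation \<open>(1 - u\<^sup>2) F' = 1\<close>. For the cotangent,
  \<open>u coth u = u + 2 u / (e\<^bsup>2 u\<^esup> - 1)\<close> gives the even coefficients and parity kills the odd
  ones. Since all coefficients are thereby seen to be rational, \<open>P\<^sub>k\<close> and \<open>Q\<^sub>k\<close> are rational
  polynomials.

  The arguments take place over an arbitrary field of characteristic 0, in which the rational
  coefficients are embedded. The theorem itself is the case of the field of rational functions, with
  y the indeterminate x.
\<close>

section \<open>Powers of a series with polynomial exponent\<close>

text \<open>Expanding \<open>exp (y log F)\<close> and using that \<open>log F\<close> has no constant term, only the powers
  \<open>(y log F) ^ i\<close> with \<open>i \<le> k\<close> contribute to the coefficient of \<open>u ^ k\<close>.\<close>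

definition pow_poly :: "'a::field_char_0 fps \<Rightarrow> nat \<Rightarrow> 'a poly" where
  "pow_poly F k = (\<Sum>i\<le>k. monom ((fps_log F ^ i) $ k / fact i) i)"

lemma fps_log_nth_0 [simp]: "fps_log F $ 0 = 0"
  by (simp add: fps_log_def)

lemma fps_pow_nth: "fps_pow F y $ k = poly (pow_poly F k) y"
  unfolding fps_pow_def pow_poly_def fps_compose_nth poly_sum poly_monom atLeast0AtMost
  by (intro sum.cong refl) (simp add: power_mult_distrib fps_const_power)

text \<open>The logarithm series is the compositional inverse of \<open>exp u - 1\<close>, which reduces the claim to
  associativity of composition.\<close>

lemma fps_exp_log:
  fixes F :: "'a::field_char_0 fps"
  assumes "F $ 0 = 1"
  shows "fps_exp 1 oo fps_log F = F"
proof -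
  have "fps_exp 1 oo fps_log F = (fps_exp 1 oo fps_ln 1) oo (F - 1)"
    unfolding fps_log_def using assms by (intro fps_compose_assoc) auto
  also have "fps_exp 1 oo fps_ln 1 = ((fps_exp 1 - 1) oo fps_ln 1) + (1 :: 'a fps)"
    by (simp add: fps_compose_sub_distrib)
  also have "(fps_exp 1 - 1) oo fps_ln 1 = (fps_X :: 'a fps)"
    by (simp add: fps_ln_fps_exp_inv fps_inv_right)
  finally show ?thesis
    using assms by (simp add: fps_compose_add_distrib)
qed

lemma fps_pow_of_nat:
  fixes F :: "'a::field_char_0 fps"
  assumes "F $ 0 = 1"
  shows "fps_pow F (of_nat n) = F ^ n"
proof -
  have "fps_pow F (of_nat n) = fps_exp (of_nat n) oo fps_log F"
    unfolding fps_pow_def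
    by (intro fps_ext) (simp add: fps_compose_nth power_mult_distrib fps_const_power)
  also have "\<dots> = (fps_exp 1 oo fps_log F) ^ n"
    by (simp add: fps_compose_power fps_exp_power_mult)
  finally show ?thesis
    using assms by (simp add: fps_exp_log)
qed

lemma poly_pow_poly_of_nat:
  "F $ 0 = 1 \<Longrightarrow> poly (pow_poly F k) (of_nat n) = (F ^ n) $ k"
  by (simp flip: fps_pow_nth add: fps_pow_of_nat)

text \<open>This is how identities for powers with natural exponents become identities of polynomials.\<close>

lemma poly_eqI_of_nat:
  fixes p q :: "'a::{idom,ring_char_0} poly"
  assumes "\<And>n. n \<ge> k \<Longrightarrow> poly p (of_nat n) = poly q (of_nat n)"
  shows "p = q"
proof (rule ccontr)
  assume "p \<noteq> q"
  hence "finite {y. poly (p - q) y = 0}"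
    by (intro poly_roots_finite) simp
  moreover have "of_nat ` {k..} \<subseteq> {y. poly (p - q) y = 0}"
    using assms by auto
  ultimately have "finite (of_nat ` {k..} :: 'a set)"
    by (rule finite_subset[rotated])
  hence "finite {k..}"
    by (rule finite_imageD) (simp add: inj_on_def)
  thus False by (simp add: infinite_Ici)
qed

text \<open>Differentiate \<open>exp (log F) = F\<close>.\<close>

lemma fps_log_deriv:
  fixes F :: "'a::field_char_0 fps"
  assumes "F $ 0 = 1"
  shows "F * fps_deriv (fps_log F) = fps_deriv F"
proof -
  have "fps_deriv (fps_exp 1 oo fps_log F) = (fps_exp 1 oo fps_log F) * fps_deriv (fps_log F)"
    by (subst fps_compose_deriv) simp_all
  thus ?thesis by (simp add: fps_exp_log[OF assms])
qed

section \<open>Extension of scalars\<close>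

text \<open>The coefficientwise embedding is a ring homomorphism that commutes with composition, hence with
  logarithms and powers. It links the rational numbers \<^const>\<open>theta\<close> and \<^const>\<open>bernoulli\<close> with
  series over other fields of characteristic 0.\<close>

definition fps_of_rat :: "rat fps \<Rightarrow> 'a::field_char_0 fps" where
  "fps_of_rat F = Abs_fps (\<lambda>n. of_rat (F $ n))"

lemma fps_of_rat_nth [simp]: "fps_of_rat F $ n = of_rat (F $ n)"
  by (simp add: fps_of_rat_def)

lemma fps_of_rat_1 [simp]: "fps_of_rat 1 = 1"
  and fps_of_rat_X [simp]: "fps_of_rat fps_X = fps_X"
  by (auto simp: fps_eq_iff)

lemma fps_of_rat_diff [simp]: "fps_of_rat (F - G) = fps_of_rat F - fps_of_rat G"
  and fps_of_rat_mult [simp]: "fps_of_rat (F * G) = fps_of_rat F * fps_of_rat G"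
  by (auto simp: fps_eq_iff of_rat_diff of_rat_mult of_rat_sum fps_mult_nth)

lemma fps_of_rat_power [simp]: "fps_of_rat (F ^ n) = fps_of_rat F ^ n"
  by (induction n) auto

lemma fps_of_rat_compose [simp]: "fps_of_rat (F oo G) = fps_of_rat F oo fps_of_rat G"
  by (simp add: fps_eq_iff fps_compose_nth of_rat_sum of_rat_mult flip: fps_of_rat_power)

lemma of_rat_fact [simp]: "of_rat (fact n) = fact n"
  by (metis of_nat_fact of_rat_of_nat_eq)

lemma fps_of_rat_exp [simp]: "fps_of_rat (fps_exp 1) = fps_exp 1"
  by (simp add: fps_eq_iff of_rat_divide)

lemma fps_of_rat_log [simp]:
  "fps_of_rat (fps_log F) = (fps_log (fps_of_rat F) :: 'a::field_char_0 fps)"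
proof -
  have "fps_of_rat (fps_ln 1) = (fps_ln 1 :: 'a fps)"
    by (simp add: fps_eq_iff fps_ln_nth of_rat_divide of_rat_power)
  thus ?thesis by (simp add: fps_log_def)
qed

lemma pow_poly_of_rat: "pow_poly (fps_of_rat F) k = map_poly of_rat (pow_poly F k)"
  by (simp add: poly_eq_iff coeff_map_poly pow_poly_def coeff_sum of_rat_sum of_rat_divide
      if_distrib flip: fps_of_rat_log fps_of_rat_power cong: if_cong)

lemma poly_map_poly_of_rat:
  "poly (map_poly of_rat p) (of_rat r :: 'a::field_char_0) = of_rat (poly p r)"
  by (simp add: poly_altdef coeff_map_poly of_rat_sum of_rat_mult of_rat_power degree_map_poly)

text \<open>Evaluation at the indeterminate is the inclusion of the polynomials in the rational functions.
  The induction on the polynomial reduces this to constants, that is, to the fact that the canonical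
  embedding of the rational numbers goes through the constant polynomials.\<close>

lemma poly_map_poly_indet: "poly (map_poly of_rat p) indet = to_fract p"
proof (induction p)
  case (pCons a p)
  have nat: "of_nat n = to_fract [:of_nat n:]" for n
    by (induction n) (auto simp: one_pCons simp flip: to_fract_1 to_fract_add)
  have "of_rat a = to_fract [:a:]"
  proof (cases a)
    case (Fract m n)
    have int: "of_int i = to_fract [:of_int i:]" for i
    proof (cases i rule: int_cases2)
      case (nonneg n) thus ?thesis by (simp add: nat)
    next
      case (nonpos n) thus ?thesis by (simp add: nat flip: to_fract_uminus)
    qed
    have "of_rat a * of_int n = (of_int m :: rat poly fract)"
      using Fract by (simp add: of_rat_rat)
    also have "\<dots> = to_fract [:a:] * of_int n"
      using Fract by (simp add: int Fract_of_int_quotient flip: to_fract_mult)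
    finally show ?thesis using Fract by simp
  qed
  thus ?case
    using pCons
    by (simp add: map_poly_pCons indet_def flip: to_fract_add to_fract_mult)
qed auto


section \<open>Lagrange inversion\<close>

text \<open>As f has no constant term, \<open>f ^ i\<close> starts at \<open>u ^ i\<close>; so the sum may be cut off at n, uniformly
  in the coefficients of the composition, and interchanged with the sum of the product.\<close>

lemma fps_compose_times_nth:
  fixes H f G :: "'a::idom fps"
  assumes "f $ 0 = 0"
  shows "((H oo f) * G) $ n = (\<Sum>i\<le>n. H $ i * (f ^ i * G) $ n)"
proof -
  have "(H oo f) $ j = (\<Sum>i\<le>n. H $ i * (f ^ i) $ j)" if "j \<le> n" for j
    unfolding fps_compose_nth using that assms
    by (intro sum.mono_neutral_left) (auto simp: startsby_zero_power_prefix)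
  hence "((H oo f) * G) $ n = (\<Sum>j\<le>n. \<Sum>i\<le>n. H $ i * (f ^ i) $ j * G $ (n - j))"
    by (simp add: fps_mult_nth sum_distrib_right atLeast0AtMost)
  also have "\<dots> = (\<Sum>i\<le>n. \<Sum>j\<le>n. H $ i * (f ^ i) $ j * G $ (n - j))"
    by (rule sum.swap)
  finally show ?thesis
    by (simp add: fps_mult_nth sum_distrib_left atLeast0AtMost mult.assoc)
qed

text \<open>With \<open>f = u / \<phi>\<close>, the usual proof takes the residue of
  \<open>(H \<circ> f)' / f\<^bsup>n\<^esup> = \<Sum>\<^sub>i i H\<^sub>i f\<^bsup>i - 1 - n\<^esup> f'\<close>: each term with \<open>i \<noteq> n\<close> is a
  derivative, and the term with \<open>i = n\<close> is a logarithmic derivative with residue 1. Multiplication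
  by \<open>u ^ n\<close> turns \<open>f\<^bsup>-n\<^esup>\<close> into \<open>\<phi>\<^sup>n\<close> and the residue into the coefficient of
  \<open>u\<^bsup>n - 1\<^esup>\<close>, so that no negative exponents occur. Here \<open>n = N + 1\<close>, and in the proof \<open>kernel\<close>
  is the evaluation of the residues.\<close>

lemma fps_lagrange_buermann:
  fixes f \<phi> H :: "'a::field_char_0 fps"
  assumes "f * \<phi> = fps_X" and "f $ 0 = 0"
  shows "of_nat (Suc N) * H $ Suc N = (fps_deriv (H oo f) * \<phi> ^ Suc N) $ N"
proof -
  have f_pow: "f ^ i * \<phi> ^ i = fps_X ^ i" for i
    using assms(1) by (metis power_mult_distrib)
  have f'\<phi>: "fps_deriv f * \<phi> = 1 - f * fps_deriv \<phi>"
    using arg_cong[OF assms(1), of fps_deriv] by (simp add: algebra_simps)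
  have kernel: "(f ^ i * (fps_deriv f * \<phi> ^ Suc N)) $ N = (if i = N then 1 else 0)"
    if "i \<le> N" for i
  proof -
    define j where "j = N - i"
    have N: "N = i + j" using that by (simp add: j_def)
    have "f ^ i * (fps_deriv f * \<phi> ^ Suc N)
            = (f ^ i * \<phi> ^ i) * (\<phi> ^ j * (fps_deriv f * \<phi>))"
      by (simp add: N power_add mult_ac)
    also have "\<phi> ^ j * (fps_deriv f * \<phi>) = \<phi> ^ j - \<phi> ^ j * f * fps_deriv \<phi>"
      by (simp only: f'\<phi>) (simp add: algebra_simps)
    finally have eq: "(f ^ i * (fps_deriv f * \<phi> ^ Suc N)) $ N
                        = (\<phi> ^ j - \<phi> ^ j * f * fps_deriv \<phi>) $ j"
      by (simp add: f_pow N fps_X_power_mult_nth)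
    show ?thesis
    proof (cases j)
      case 0
      thus ?thesis unfolding eq using assms(2) by (simp add: N)
    next
      case (Suc l)
      (* The remaining expression is \<phi>^j - (u/j) (\<phi>^j)', whose coefficient of u^j vanishes. *)
      have "\<phi> ^ j * f * fps_deriv \<phi> = (f * \<phi>) * (\<phi> ^ l * fps_deriv \<phi>)"
        by (simp add: Suc mult_ac)
      hence X: "\<phi> ^ j * f * fps_deriv \<phi> = fps_X * (\<phi> ^ l * fps_deriv \<phi>)"
        by (simp only: assms(1))
      have "fps_deriv (\<phi> ^ j) = fps_const (of_nat j) * (\<phi> ^ l * fps_deriv \<phi>)"
        by (simp add: fps_deriv_power Suc mult_ac del: of_nat_Suc power_Suc)
      hence "fps_deriv (\<phi> ^ j) $ l = of_nat j * (\<phi> ^ l * fps_deriv \<phi>) $ l"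
        by simp
      hence "(\<phi> ^ j * f * fps_deriv \<phi>) $ j = (\<phi> ^ j) $ j"
        unfolding X by (simp add: Suc del: of_nat_Suc power_Suc)
      thus ?thesis unfolding eq using Suc by (simp add: N del: power_Suc)
    qed
  qed
  have "fps_deriv (H oo f) * \<phi> ^ Suc N = (fps_deriv H oo f) * (fps_deriv f * \<phi> ^ Suc N)"
    by (simp add: fps_compose_deriv[OF assms(2)] mult.assoc)
  hence "(fps_deriv (H oo f) * \<phi> ^ Suc N) $ N
          = (\<Sum>i\<le>N. fps_deriv H $ i * (if i = N then 1 else 0))"
    by (simp only: fps_compose_times_nth[OF assms(2)])
      (intro sum.cong refl arg_cong2[where f = "(*)"] kernel, simp)
  thus ?thesis by (simp add: if_distrib cong: if_cong)
qed

text \<open>The case \<open>H = g\<^sup>m\<close>, for which \<open>H \<circ> f = u\<^sup>m\<close>.\<close>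

corollary fps_lagrange_power:
  fixes f \<phi> g :: "'a::field_char_0 fps"
  assumes "f * \<phi> = fps_X" and "f $ 0 = 0" and "g oo f = fps_X" and "m \<le> n"
  shows "of_nat n * (g ^ m) $ n = of_nat m * (\<phi> ^ n) $ (n - m)"
proof (cases "m = 0")
  case True
  thus ?thesis by simp
next
  case False
  then obtain N l where n: "n = Suc N" and m: "m = Suc l"
    using assms(4) by (metis Suc_le_D not0_implies_Suc)
  have "g ^ m oo f = fps_X ^ m"
    by (simp only: fps_compose_power[OF assms(2), symmetric] assms(3))
  hence "fps_deriv (g ^ m oo f) = of_nat m * fps_X ^ l"
    by (simp add: m fps_deriv_power' del: power_Suc of_nat_Suc)
  hence "of_nat n * (g ^ m) $ n = (of_nat m * (fps_X ^ l * \<phi> ^ n)) $ N"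
    using fps_lagrange_buermann[OF assms(1,2), of N "g ^ m"] by (simp only: n mult.assoc)
  also have "\<dots> = of_nat m * (\<phi> ^ n) $ (N - l)"
    using assms(4) by (simp add: n m fps_X_power_mult_nth del: of_nat_Suc power_Suc)
  finally show ?thesis by (simp add: n m)
qed

section \<open>The series artanh u and u coth u\<close>

lemma even_series_nth: "even_series a $ n = (if even n then a (n div 2) else 0)"
proof -
  have "even_series a $ n = (\<Sum>i=0..n. if n = 2 * i then a i else 0)"
    unfolding even_series_def fps_compose_nth
    by (intro sum.cong) (auto simp flip: power_mult)
  also have "\<dots> = (\<Sum>i=0..n. if i = n div 2 then if even n then a i else 0 else 0)"
    by (intro sum.cong) auto
  also have "\<dots> = (if even n then a (n div 2) else 0)"
    by (subst sum.delta) auto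
  finally show ?thesis .
qed

lemma fps_of_rat_even_series: "fps_of_rat (even_series a) = even_series (\<lambda>j. of_rat (a j))"
  by (simp add: fps_eq_iff even_series_nth)

lemma fps_cosh_nth_0 [simp]: "fps_cosh $ 0 = 1"
  and fps_sinh_nth_0 [simp]: "fps_sinh $ 0 = 0"
  and fps_sinh_nth_1 [simp]: "fps_sinh $ Suc 0 = 1"
  by (simp_all add: fps_cosh_def fps_sinh_def)

lemma fps_deriv_sinh [simp]: "fps_deriv fps_sinh = fps_cosh"
  and fps_deriv_cosh [simp]: "fps_deriv fps_cosh = fps_sinh"
  by (simp_all add: fps_sinh_def fps_cosh_def flip: fps_const_neg)

lemma fps_tanh_props:
  defines "T \<equiv> (fps_sinh / fps_cosh :: 'a::field_char_0 fps)"
  shows fps_tanh_times_cosh: "T * fps_cosh = fps_sinh"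
    and fps_tanh_nth_0: "T $ 0 = 0"
    and fps_tanh_nth_1: "T $ 1 = 1"
    and fps_deriv_tanh: "fps_deriv T = 1 - T\<^sup>2"
proof -
  have nz: "fps_cosh \<noteq> (0 :: 'a fps)"
    by (metis fps_cosh_nth_0 fps_zero_nth zero_neq_one)
  show *: "T * fps_cosh = fps_sinh"
    by (simp add: T_def fps_divide_unit mult.assoc inverse_mult_eq_1)
  show 0: "T $ 0 = 0"
    using arg_cong[OF *, of "\<lambda>F. F $ 0"] by simp
  show "T $ 1 = 1"
    using arg_cong[OF *, of "\<lambda>F. F $ 1"] 0 by simp
  have "fps_deriv T * fps_cosh = (1 - T\<^sup>2) * fps_cosh"
  proof -
    have "fps_deriv T * fps_cosh = fps_cosh - T * fps_sinh"
      using arg_cong[OF *, of fps_deriv] by (simp add: algebra_simps)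
    also have "\<dots> = (1 - T\<^sup>2) * fps_cosh"
      by (simp only: *[symmetric]) (simp add: algebra_simps power2_eq_square)
    finally show ?thesis .
  qed
  thus "fps_deriv T = 1 - T\<^sup>2" using nz by simp
qed

text \<open>Since \<open>tanh' = 1 - tanh\<^sup>2\<close>, differentiating \<open>tanh (artanh u) = u\<close> gives the differential
  equation.\<close>

lemma fps_artanh_props:
  shows fps_artanh_compose_tanh:
      "fps_artanh oo (fps_sinh / fps_cosh) = (fps_X :: 'a::field_char_0 fps)"
    and fps_artanh_nth_0 [simp]: "fps_artanh $ 0 = (0 :: 'a)"
    and fps_deriv_artanh: "(1 - fps_X\<^sup>2) * fps_deriv fps_artanh = (1 :: 'a fps)"
proof -
  let ?T = "fps_sinh / fps_cosh :: 'a fps"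
  note T = fps_tanh_nth_0[where ?'a = 'a] fps_tanh_nth_1[where ?'a = 'a]
  show "fps_artanh oo ?T = fps_X"
    unfolding fps_artanh_def using T by (intro fps_inv) simp_all
  show 0: "fps_artanh $ 0 = (0 :: 'a)"
    by (simp add: fps_artanh_def fps_inv_def)
  have right: "?T oo fps_artanh = fps_X"
    unfolding fps_artanh_def using T by (intro fps_inv_right) simp_all
  have "(1 - ?T\<^sup>2) oo fps_artanh = 1 - fps_X\<^sup>2"
    by (simp add: fps_compose_sub_distrib fps_compose_power[OF 0, symmetric] right)
  thus "(1 - fps_X\<^sup>2) * fps_deriv fps_artanh = (1 :: 'a fps)"
    using arg_cong[OF right, of fps_deriv]
    by (simp add: fps_compose_deriv[OF 0] fps_deriv_tanh)
qed

lemma fps_one_minus_X_square_neq_0: "1 - fps_X\<^sup>2 \<noteq> (0 :: 'a::field_char_0 fps)"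
  by (rule fps_nonzeroI[of _ 0]) simp

text \<open>The differential equation and the constant term characterise artanh. This criterion identifies
  it with both other expressions for it.\<close>

lemma fps_eq_artanhI:
  fixes F :: "'a::field_char_0 fps"
  assumes "F $ 0 = 0" and "(1 - fps_X\<^sup>2) * fps_deriv F = 1"
  shows "F = fps_artanh"
proof -
  have "(1 - fps_X\<^sup>2) * fps_deriv F = (1 - fps_X\<^sup>2) * fps_deriv fps_artanh"
    using assms(2) fps_deriv_artanh by metis
  hence "fps_deriv F = fps_deriv fps_artanh"
    by (simp only: mult_left_cancel[OF fps_one_minus_X_square_neq_0])
  thus ?thesis
    using assms(1) by (simp add: fps_deriv_eq_iff)
qed

lemma fps_artanh_conv_even_series:
  "fps_artanh = fps_X * even_series (\<lambda>j. 1 / of_nat (2 * j + 1) :: 'a::field_char_0)"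
proof (rule sym, rule fps_eq_artanhI)
  let ?E = "fps_X * even_series (\<lambda>j. 1 / of_nat (2 * j + 1) :: 'a)"
  have "fps_deriv ?E $ n = (if even n then 1 else 0)" for n
  proof -
    have "fps_deriv ?E $ n = of_nat (Suc n) * (if even n then 1 / of_nat (Suc n) else 0)"
      by (simp only: fps_deriv_nth Suc_eq_plus1[symmetric])
        (simp add: even_series_nth del: of_nat_Suc)
    thus ?thesis by (simp del: of_nat_Suc)
  qed
  hence d: "fps_deriv ?E = Abs_fps (\<lambda>n. if even n then 1 else 0)"
    by (intro fps_ext) simp
  show "(1 - fps_X\<^sup>2) * fps_deriv ?E = 1"
    unfolding d
    by (rule fps_ext) (auto simp: left_diff_distrib fps_X_power_mult_nth less_2_cases_iff)
qed simp

lemma fps_artanh_over_X: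
  "fps_artanh / fps_X = even_series (\<lambda>j. 1 / of_nat (2 * j + 1) :: 'a::field_char_0)"
  unfolding fps_artanh_conv_even_series
  by (subst mult.commute) (simp only: fps_divide_times_eq fps_X_neq_zero not_False_eq_True)

text \<open>The series \<open>F = (1 + u) / (1 - u)\<close> satisfies \<open>F' (1 - u)\<^sup>2 = 2\<close> and hence
  \<open>(1 - u\<^sup>2) F' / F = 2\<close>, so half of its logarithm satisfies the equation of artanh.\<close>

lemma fps_log_conv_artanh:
  "fps_log ((1 + fps_X) / (1 - fps_X)) = fps_const 2 * (fps_artanh :: 'a::field_char_0 fps)"
proof -
  define F :: "'a fps" where "F = (1 + fps_X) / (1 - fps_X)"
  let ?L = "fps_deriv (fps_log F)"
  have F: "F * (1 - fps_X) = 1 + fps_X"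
    by (simp add: F_def fps_divide_unit mult.assoc inverse_mult_eq_1)
  have F0: "F $ 0 = 1"
    by (simp add: F_def)
  have nz: "F \<noteq> 0" using F0 by force
  have "fps_deriv F * (1 - fps_X) = 1 + F"
    using arg_cong[OF F, of fps_deriv] by (simp add: algebra_simps)
  hence "fps_deriv F * (1 - fps_X) * (1 - fps_X) = 2"
    using F by (simp add: distrib_right)
  moreover have "F * ((1 - fps_X\<^sup>2) * ?L) = F * (1 - fps_X) * (1 + fps_X) * ?L"
    by (simp add: algebra_simps power2_eq_square)
  moreover have "\<dots> = F * (1 - fps_X) * (F * (1 - fps_X)) * ?L"
    by (simp only: F)
  moreover have "\<dots> = F * (fps_deriv F * (1 - fps_X) * (1 - fps_X))"
    by (simp only: fps_log_deriv[OF F0, symmetric] mult_ac)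
  ultimately have "F * ((1 - fps_X\<^sup>2) * ?L) = F * 2"
    by metis
  hence "(1 - fps_X\<^sup>2) * ?L = 2" by (simp only: mult_left_cancel[OF nz])
  hence "(1 - fps_X\<^sup>2) * fps_deriv (fps_const (1 / 2) * fps_log F) = 1"
    by (simp add: mult.left_commute[of _ "fps_const _"] numeral_fps_const)
  hence "fps_const (1 / 2) * fps_log F = fps_artanh"
    by (intro fps_eq_artanhI) auto
  hence "fps_const 2 * fps_artanh = fps_const 2 * (fps_const (1 / 2) * fps_log F)"
    by simp
  thus ?thesis by (simp add: F_def mult.assoc[symmetric])
qed


lemma fps_X_coth_times_sinh: "fps_X_coth * fps_sinh = (fps_X * fps_cosh :: 'a::field_char_0 fps)"
proof -
  have "subdegree (fps_sinh :: 'a fps) = 1"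
    by (intro subdegreeI) auto
  moreover have "fps_sinh \<noteq> (0 :: 'a fps)"
    by (rule fps_nonzeroI[of _ 1]) simp
  ultimately show ?thesis
    unfolding fps_X_coth_def
    by (intro fps_times_divide_eq)
       (auto simp: subdegree_mult fps_nonzeroI[of _ 0])
qed

text \<open>The factorisation of u under which Lagrange inversion relates artanh to \<open>u coth u\<close>.\<close>

lemma fps_tanh_times_X_coth: "fps_sinh / fps_cosh * fps_X_coth = (fps_X :: 'a::field_char_0 fps)"
proof -
  have "fps_cosh * (fps_sinh / fps_cosh * fps_X_coth) = fps_cosh * (fps_X :: 'a fps)"
    using fps_tanh_times_cosh[where ?'a = 'a] fps_X_coth_times_sinh[where ?'a = 'a]
    by (metis mult.assoc mult.commute)
  moreover have "fps_cosh \<noteq> (0 :: 'a fps)"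
    by (rule fps_nonzeroI[of _ 0]) simp
  ultimately show ?thesis by simp
qed

text \<open>Stated without division: the division in the definition of the Bernoulli numbers is exact, because
  \<open>e\<^sup>u - 1\<close> starts at u, and the resulting product formula passes from the rational numbers to any
  field of characteristic 0.\<close>

lemma bernoulli_series:
  "Abs_fps (\<lambda>n. of_rat (bernoulli n) / fact n) * (fps_exp 1 - 1) = (fps_X :: 'a::field_char_0 fps)"
proof -
  have nth: "(fps_exp 1 - 1) $ 0 = (0::rat)" "(fps_exp 1 - 1) $ Suc 0 = (1::rat)"
    by simp_all
  hence nz: "fps_exp 1 - 1 \<noteq> (0 :: rat fps)" by (metis fps_zero_nth zero_neq_one)
  have "subdegree (fps_exp 1 - 1 :: rat fps) = 1"
    using nth by (intro subdegreeI) auto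
  hence "fps_X / (fps_exp 1 - 1) * (fps_exp 1 - 1) = (fps_X :: rat fps)"
    using nz by (intro fps_times_divide_eq) auto
  hence "fps_of_rat (fps_X / (fps_exp 1 - 1)) * fps_of_rat (fps_exp 1 - 1) = (fps_X :: 'a fps)"
    by (metis fps_of_rat_mult fps_of_rat_X)
  moreover have "fps_of_rat (fps_X / (fps_exp 1 - 1))
                   = (Abs_fps (\<lambda>n. of_rat (bernoulli n) / fact n) :: 'a fps)"
    by (rule fps_ext)
      (simp only: fps_of_rat_nth fps_nth_Abs_fps bernoulli_def, simp add: of_rat_mult)
  ultimately show ?thesis by simp
qed

text \<open>Writing \<open>\<beta>(u) = u / (e\<^sup>u - 1)\<close>, one has \<open>u coth u = u + \<beta>(2 u)\<close>. The left-hand side is even, so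
  its odd coefficients vanish; in even degree the summand u does not contribute.\<close>

lemma fps_X_coth_conv_even_series:
  "fps_X_coth = even_series
     (\<lambda>j. 2 ^ (2 * j) * (of_rat (bernoulli (2 * j)) / fact (2 * j)) :: 'a::field_char_0)"
proof -
  let ?\<beta> = "Abs_fps (\<lambda>n. of_rat (bernoulli n) / fact n) :: 'a fps"
  let ?\<gamma> = "?\<beta> oo (fps_const 2 * fps_X)"
  have nz: "fps_sinh \<noteq> (0 :: 'a fps)"
    by (rule fps_nonzeroI[of _ 1]) simp
  have \<gamma>: "?\<gamma> * (fps_exp 2 - 1) = fps_const 2 * fps_X"
    using arg_cong[OF bernoulli_series[where ?'a = 'a], of "\<lambda>F. F oo (fps_const 2 * fps_X)"]
    by (simp add: fps_compose_mult_distrib fps_compose_sub_distrib)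
  have exp: "fps_exp (- 1) * fps_exp 2 = (fps_exp 1 :: 'a fps)"
    by (simp flip: fps_exp_add_mult)
  have "?\<gamma> * fps_sinh = fps_const (1 / 2) * fps_exp (- 1) * (?\<gamma> * (fps_exp 2 - 1))"
    by (simp add: fps_sinh_def algebra_simps flip: exp)
  also have "\<dots> = fps_X * fps_exp (- 1)"
    by (simp only: \<gamma>) (simp add: mult.left_commute mult.commute flip: mult.assoc)
  finally have "(fps_X + ?\<gamma>) * fps_sinh = fps_X * (fps_sinh + fps_exp (- 1))"
    by (simp add: algebra_simps)
  also have "fps_sinh + fps_exp (- 1) = (fps_cosh :: 'a fps)"
    by (rule fps_ext) (simp add: fps_sinh_def fps_cosh_def field_simps)
  finally have "(fps_X + ?\<gamma>) * fps_sinh = fps_X_coth * fps_sinh"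
    by (simp add: fps_X_coth_times_sinh)
  hence coth: "fps_X_coth = fps_X + ?\<gamma>"
    using nz by simp
  have "(fps_X_coth oo - fps_X) * (fps_sinh oo - fps_X) = (fps_X * fps_cosh) oo (- fps_X :: 'a fps)"
    by (simp flip: fps_compose_mult_distrib add: fps_X_coth_times_sinh)
  also have "fps_sinh oo - fps_X = - (fps_sinh :: 'a fps)"
    by (simp add: fps_sinh_def fps_compose_mult_distrib fps_compose_sub_distrib algebra_simps)
  also have "(fps_X * fps_cosh) oo - fps_X = - (fps_X * fps_cosh :: 'a fps)"
    by (simp add: fps_cosh_def fps_compose_mult_distrib fps_compose_add_distrib algebra_simps)
  finally have "(fps_X_coth oo - fps_X) * fps_sinh = fps_X_coth * (fps_sinh :: 'a fps)"
    by (simp add: fps_X_coth_times_sinh)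
  hence even: "fps_X_coth oo - fps_X = (fps_X_coth :: 'a fps)"
    using nz by simp
  show ?thesis
  proof (rule fps_ext)
    fix n
    show "fps_X_coth $ n = even_series
      (\<lambda>j. 2 ^ (2 * j) * (of_rat (bernoulli (2 * j)) / fact (2 * j)) :: 'a) $ n"
    proof (cases "even n")
      case True
      thus ?thesis by (auto simp: coth even_series_nth)
    next
      case False
      have "fps_X_coth $ n = - (fps_X_coth $ n :: 'a)"
        using False arg_cong[OF even, of "\<lambda>F. F $ n"] by (simp add: fps_compose_uminus')
      thus ?thesis using False by (simp add: even_series_nth)
    qed
  qed
qed

lemma fps_X_coth_nth_0: "fps_X_coth $ 0 = (1 :: 'a::field_char_0)"
  using arg_cong[OF fps_X_coth_times_sinh[where ?'a = 'a], of "\<lambda>F. F $ 1"] by simp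

lemma fps_of_rat_artanh_over_X: "fps_of_rat (fps_artanh / fps_X) = fps_artanh / fps_X"
  unfolding fps_artanh_over_X fps_of_rat_even_series
  by (simp add: of_rat_divide of_rat_add of_rat_mult)

lemma fps_of_rat_X_coth: "fps_of_rat fps_X_coth = fps_X_coth"
  unfolding fps_X_coth_conv_even_series fps_of_rat_even_series
  by (simp add: of_rat_mult of_rat_power of_rat_divide)

section \<open>Tanh polynomials\<close>

lemma fps_artanh_power_nth:
  fixes B :: "'a::field_char_0 fps"
  defines "B \<equiv> fps_artanh / fps_X"
  assumes "k \<le> n"
  shows "(fps_artanh ^ (n - k)) $ n = (B ^ (n - k)) $ k"
proof -
  have "fps_artanh = fps_X * B"
    unfolding B_def fps_artanh_over_X by (rule fps_artanh_conv_even_series)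
  hence "fps_artanh ^ (n - k) = fps_X ^ (n - k) * B ^ (n - k)"
    by (simp only: power_mult_distrib[symmetric])
  thus ?thesis
    using assms(2) by (simp add: fps_X_power_mult_nth)
qed

lemma fps_artanh_over_X_nth_0: "(fps_artanh / fps_X) $ 0 = 1"
  by (simp only: fps_artanh_over_X even_series_nth) simp

lemma fact_eq_falling_factorial_times_fact:
  assumes "k \<le> n"
  shows "(fact n :: 'a::field_char_0) = (\<Prod>i<k. of_nat n - of_nat i) * fact (n - k)"
  using assms
proof (induction k)
  case (Suc k)
  have "(fact (n - k) :: 'a) = of_nat (n - k) * fact (n - Suc k)"
    using Suc.prems by (metis Suc_diff_Suc Suc_le_eq fact_Suc of_nat_fact of_nat_mult)
  thus ?case using Suc by (simp add: of_nat_diff mult.assoc)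
qed simp

lemma theta_artanh_power:
  assumes "k \<le> n"
  shows "theta n (n - k) = (\<Prod>i<k. of_nat n - of_nat i)
           * poly (pow_poly (fps_artanh / fps_X) k) (of_nat n - of_nat k)"
proof -
  have "theta n (n - k) = (\<Prod>i<k. of_nat n - of_nat i) * ((fps_artanh / fps_X) ^ (n - k)) $ k"
    by (simp add: theta_def fact_eq_falling_factorial_times_fact[OF assms]
        fps_artanh_power_nth[OF assms] del: fps_divide_X)
  also have "((fps_artanh / fps_X) ^ (n - k)) $ k
               = poly (pow_poly (fps_artanh / fps_X :: rat fps) k) (of_nat (n - k))"
    by (rule poly_pow_poly_of_nat[OF fps_artanh_over_X_nth_0, symmetric])
  finally show ?thesis
    using assms by (simp add: of_nat_diff)
qed

text \<open>The polynomial that defines \<^const>\<open>theta_poly\<close> as a unique choice exists, by the previous lemma,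
  and is unique, because its values at all \<open>n \<ge> k\<close> are prescribed.\<close>

lemma poly_theta_poly:
  assumes "k \<le> n"
  shows "poly (theta_poly k) (of_nat n) = theta n (n - k)"
proof -
  define p where "p = (\<Prod>i<k. [:- of_nat i, 1:])
    * pcompose (pow_poly (fps_artanh / fps_X) k) [:- of_nat k, 1 :: rat:]"
  have p: "\<forall>n\<ge>k. poly p (of_nat n) = theta n (n - k)"
    by (auto simp: p_def poly_prod poly_pcompose theta_artanh_power simp del: fps_divide_X)
  have "\<forall>n\<ge>k. poly (theta_poly k) (of_nat n) = theta n (n - k)"
    unfolding theta_poly_def
  proof (rule theI[where P = "\<lambda>p. \<forall>n\<ge>k. poly p (of_nat n) = theta n (n - k)"])
    show "q = p" if "\<forall>n\<ge>k. poly q (of_nat n) = theta n (n - k)" for q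
      using that p by (intro poly_eqI_of_nat[of k]) simp
  qed (fact p)
  thus ?thesis using assms by blast
qed

text \<open>Both sides are polynomials in y that agree with \<open>\<theta>(n, n - k)\<close> at \<open>y = n \<ge> k\<close>. Comparing them
  over the field of y itself extends the previous identity to arguments that are not rational.\<close>

lemma poly_map_theta_poly:
  fixes y :: "'a::field_char_0"
  shows "poly (map_poly of_rat (theta_poly k)) y
           = (\<Prod>i<k. y - of_nat i) * poly (pow_poly (fps_artanh / fps_X) k) (y - of_nat k)"
proof -
  define q :: "'a poly" where "q = (\<Prod>i<k. [:- of_nat i, 1:])
    * pcompose (pow_poly (fps_artanh / fps_X) k) [:- of_nat k, 1:]"
  have "map_poly of_rat (theta_poly k) = q"
  proof (rule poly_eqI_of_nat[of k])
    fix n assume n: "k \<le> n"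
    have "poly (map_poly of_rat (theta_poly k)) (of_nat n :: 'a) = of_rat (theta n (n - k))"
      using poly_map_poly_of_rat[of "theta_poly k" "of_nat n", where ?'a = 'a]
      by (simp add: poly_theta_poly[OF n])
    also have "\<dots> = (\<Prod>i<k. of_nat n - of_nat i) * poly (map_poly of_rat
        (pow_poly (fps_artanh / fps_X) k)) (of_rat (of_nat n - of_nat k))"
      unfolding poly_map_poly_of_rat theta_artanh_power[OF n]
      by (simp add: of_rat_mult of_rat_prod of_rat_diff del: fps_divide_X)
    also have "\<dots> = poly q (of_nat n)"
      by (simp add: q_def poly_prod poly_pcompose of_rat_diff fps_of_rat_artanh_over_X
          del: fps_divide_X flip: pow_poly_of_rat)
    finally show "poly (map_poly of_rat (theta_poly k)) (of_nat n) = poly q (of_nat n)" .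
  qed
  thus ?thesis
    by (simp add: q_def poly_prod poly_pcompose del: fps_divide_X)
qed

text \<open>The hypothesis on y keeps the denominator \<open>y (y - 1) \<dots> (y - k)\<close> away from 0.\<close>

lemma tanh_delta_conv_pow_poly:
  fixes y :: "'a::field_char_0"
  assumes "y \<notin> \<nat>"
  shows "tanh_delta k y = poly (pow_poly (fps_artanh / fps_X) k) (y - of_nat k) / (y - of_nat k)"
proof -
  have "(\<Prod>i<k. y - of_nat i) \<noteq> 0"
    using assms by auto
  moreover have "(\<Prod>i\<le>k. y - of_nat i) = (\<Prod>i<k. y - of_nat i) * (y - of_nat k)"
    by (simp add: prod.lessThan_Suc flip: lessThan_Suc_atMost)
  ultimately show ?thesis
    by (simp add: tanh_delta_def poly_map_theta_poly del: fps_divide_X)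
qed

lemma times_tanh_delta_shifted:
  fixes y :: "'a::field_char_0"
  assumes "of_nat k + y \<notin> \<nat>"
  shows "y * tanh_delta k (of_nat k + y) = poly (pow_poly (fps_artanh / fps_X) k) y"
proof -
  have "y \<noteq> 0" using assms by auto
  thus ?thesis
    by (simp add: tanh_delta_conv_pow_poly[OF assms] del: fps_divide_X)
qed

text \<open>Lagrange inversion with exponent \<open>m = n - k\<close> is the case \<open>y = n\<close>, for every \<open>n \<ge> k\<close>, of
  this identity between polynomials.\<close>

lemma pow_poly_artanh_X_coth:
  fixes y :: "'a::field_char_0"
  shows "y * poly (pow_poly (fps_artanh / fps_X) k) (y - of_nat k)
           = (y - of_nat k) * poly (pow_poly fps_X_coth k) y"
proof -
  define p q :: "'a poly"
    where "p = [:0, 1:] * pcompose (pow_poly (fps_artanh / fps_X) k) [:- of_nat k, 1:]"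
      and "q = [:- of_nat k, 1:] * pow_poly fps_X_coth k"
  have "p = q"
  proof (rule poly_eqI_of_nat[of k])
    fix n assume n: "k \<le> n"
    have "poly p (of_nat n)
            = of_nat n * poly (pow_poly (fps_artanh / fps_X) k) (of_nat (n - k))"
      using n by (simp add: p_def poly_pcompose of_nat_diff del: fps_divide_X)
    also have "\<dots> = of_nat n * (fps_artanh ^ (n - k)) $ n"
      by (simp only: poly_pow_poly_of_nat fps_artanh_over_X_nth_0 fps_artanh_power_nth[OF n])
    also have "\<dots> = of_nat (n - k) * (fps_X_coth ^ n) $ (n - (n - k))"
      using fps_tanh_nth_0
      by (intro fps_lagrange_power[OF fps_tanh_times_X_coth _ fps_artanh_compose_tanh]) auto
    also have "\<dots> = poly q (of_nat n)"
      using n by (simp add: q_def poly_pow_poly_of_nat fps_X_coth_nth_0 of_nat_diff algebra_simps)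
    finally show "poly p (of_nat n) = poly q (of_nat n)" .
  qed
  hence "poly p y = poly q y" by simp
  thus ?thesis
    by (simp add: p_def q_def poly_pcompose left_diff_distrib del: fps_divide_X)
qed

lemma times_tanh_delta:
  fixes y :: "'a::field_char_0"
  assumes "y \<notin> \<nat>"
  shows "y * tanh_delta k y = poly (pow_poly fps_X_coth k) y"
proof -
  have "y - of_nat k \<noteq> 0" using assms by auto
  thus ?thesis
    using pow_poly_artanh_X_coth[of y k]
    by (simp add: tanh_delta_conv_pow_poly[OF assms] field_simps del: fps_divide_X)
qed

text \<open>The indeterminate is transcendental, so neither x nor \<open>k + x\<close> is a zero of a denominator of a
  tanh polynomial.\<close>

lemma of_nat_plus_indet_notin_Nats: "of_nat k + indet \<notin> \<nat>"
proof
  assume "of_nat k + indet \<in> \<nat>"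
  then obtain n where "of_nat k + indet = of_nat n"
    by (auto simp: Nats_def)
  hence "poly (map_poly of_rat [:of_nat k - of_nat n, 1:]) indet = 0"
    by (simp add: map_poly_pCons of_rat_diff algebra_simps)
  thus False
    by (simp only: poly_map_poly_indet) simp
qed

theorem proposition3p3:
  defines "x \<equiv> indet"
  shows
    "(\<forall>k. x * tanh_delta k x \<in> range to_fract)
     \<and> Abs_fps (\<lambda>k. x * tanh_delta k x) = fps_pow fps_X_coth x
     \<and> fps_pow fps_X_coth x
         = fps_pow (even_series (\<lambda>j. 2 ^ (2 * j) * (of_rat (bernoulli (2 * j)) / fact (2 * j)))) x
     \<and> (\<forall>k. x * tanh_delta k (of_nat k + x) \<in> range to_fract)
     \<and> Abs_fps (\<lambda>k. x * tanh_delta k (of_nat k + x)) = fps_pow (fps_artanh / fps_X) x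
     \<and> fps_pow (fps_artanh / fps_X) x
         = fps_pow (fps_log ((1 + fps_X) / (1 - fps_X)) / (fps_const 2 * fps_X)) x
     \<and> fps_pow (fps_log ((1 + fps_X) / (1 - fps_X)) / (fps_const 2 * fps_X)) x
         = fps_pow (even_series (\<lambda>j. 1 / of_nat (2 * j + 1))) x"
proof -
  have x: "x \<notin> \<nat>" "of_nat k + x \<notin> \<nat>" for k
    using of_nat_plus_indet_notin_Nats[of 0] of_nat_plus_indet_notin_Nats[of k]
    by (simp_all add: x_def)
  have poly: "poly (pow_poly (fps_of_rat F) k) x \<in> range to_fract" for F k
    by (simp add: pow_poly_of_rat x_def poly_map_poly_indet)
  have log: "fps_log ((1 + fps_X) / (1 - fps_X)) / (fps_const 2 * fps_X)
               = (fps_artanh / fps_X :: rat poly fract fps)"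
    unfolding fps_log_conv_artanh by (subst (1 2) mult.commute) (rule fps_divide_cancel, simp)
  show ?thesis
    unfolding log fps_X_coth_conv_even_series[symmetric] fps_artanh_over_X[symmetric]
    using poly[of fps_X_coth] poly[of "fps_artanh / fps_X"]
    unfolding fps_of_rat_X_coth fps_of_rat_artanh_over_X
    by (simp add: times_tanh_delta[OF x(1)] times_tanh_delta_shifted[OF x(2)]
        fps_eq_iff fps_pow_nth del: fps_divide_X)
qed

end
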